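(* For every even integer $n\ge4$, $\pi(K_n\square K_n)\le \frac{n^2}{2}$.
   Context: $K_n$ is the complete graph on $n$ vertices. For graphs $G,H$, the Cartesian product $G\square H$ has vertex set $V(G)\times V(H)$, with $(g,h)\sim(g',h')$ iff ($g=g'$ and $hh'\in E(H)$) or ($h=h'$ and $gg'\in E(G)$). A vertex coloring $c$ of a graph is non-repetitive if there is no path $v_1,\dots,v_{2k}$ ($k\ge1$, distinct vertices, consecutive ones adjacent) with $c(v_i)=c(v_{k+i})$ for all $1\le i\le k$; $\pi(G)$ denotes the minimum number of colors in a non-repetitive coloring of $G$. *)

theory Defs
  imports "Graph_Theory.Kuratowski" "Graph_Theory.Vertex_Walk" "HOL-Library.FuncSet"
begin

text \<open>
  An undirected simple graph is a symmetric loop-free digraph without parallel arcs (the locale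
  \<^locale>\<open>graph\<close>); each edge is the pair of its two orientations.
\<close>

definition cartesian_product ::
  "'a pair_pre_digraph \<Rightarrow> 'b pair_pre_digraph \<Rightarrow> ('a \<times> 'b) pair_pre_digraph" (infixr \<open>\<box>\<close> 70)
  where
  "G \<box> H = \<lparr> pverts = pverts G \<times> pverts H,
     parcs = {((g, h), (g', h')) | g h g' h'.
       (g = g' \<and> g \<in> pverts G \<and> (h, h') \<in> parcs H) \<or>
       (h = h' \<and> h \<in> pverts H \<and> (g, g') \<in> parcs G)} \<rparr>"

definition nonrepetitive :: "('a, 'b) pre_digraph \<Rightarrow> ('a \<Rightarrow> 'c) \<Rightarrow> bool" where
  "nonrepetitive G c \<longleftrightarrow>
     \<not> (\<exists>p k. k \<ge> 1 \<and> vpath p G \<and> length p = 2 * k \<and> (\<forall>i<k. c (p ! i) = c (p ! (k + i))))"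

text \<open>
  The minimum exists for every finite graph, see \<open>nonrep_number_attained\<close>; on infinite graphs
  without a suitable finite palette the value is unspecified.
\<close>

definition nonrep_number :: "('a, 'b) pre_digraph \<Rightarrow> nat" where
  "nonrep_number G = (LEAST m. \<exists>c :: 'a \<Rightarrow> nat. c \<in> verts G \<rightarrow> {..<m} \<and> nonrepetitive G c)"

lemma inj_on_nonrepetitive:
  assumes "inj_on c (verts G)"
  shows "nonrepetitive G c"
  unfolding nonrepetitive_def
proof (intro notI, elim exE conjE)
  fix p k
  assume *: "k \<ge> (1::nat)" "vpath p G" "length p = 2 * k" "\<forall>i<k. c (p ! i) = c (p ! (k + i))"
  then have "p ! 0 \<in> verts G" "p ! k \<in> verts G" "distinct p" "c (p ! 0) = c (p ! k)"
    by (fastforce simp: vpath_def vwalk_def)+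
  with assms have "p ! 0 = p ! k" by (auto dest: inj_onD)
  with * \<open>distinct p\<close> show False by (simp add: nth_eq_iff_index_eq)
qed

lemma nonrep_number_attained:
  fixes G :: "('a, 'b) pre_digraph"
  assumes "finite (verts G)"
  shows "\<exists>c :: 'a \<Rightarrow> nat. c \<in> verts G \<rightarrow> {..<nonrep_number G} \<and> nonrepetitive G c"
proof -
  obtain c :: "'a \<Rightarrow> nat" where "bij_betw c (verts G) {0..<card (verts G)}"
    using ex_bij_betw_finite_nat[OF assms] by blast
  then have "c \<in> verts G \<rightarrow> {..<card (verts G)} \<and> nonrepetitive G c"
    by (auto simp: bij_betw_def intro: inj_on_nonrepetitive)
  then have "\<exists>m. \<exists>c :: 'a \<Rightarrow> nat. c \<in> verts G \<rightarrow> {..<m} \<and> nonrepetitive G c" by blast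
  from LeastI_ex[OF this] show ?thesis unfolding nonrep_number_def .
qed

lemma graph_cartesian_product:
  assumes "graph (with_proj G)" "graph (with_proj H)"
  shows "graph (with_proj (G \<box> H))"
proof -
  interpret G: pair_graph G using assms(1) by (rule pair_graphI_graph)
  interpret H: pair_graph H using assms(2) by (rule pair_graphI_graph)
  have verts: "pverts (G \<box> H) = pverts G \<times> pverts H"
    by (simp add: cartesian_product_def)
  have arcs: "((g, h), (g', h')) \<in> parcs (G \<box> H) \<longleftrightarrow>
      (g = g' \<and> g \<in> pverts G \<and> (h, h') \<in> parcs H) \<or>
      (h = h' \<and> h \<in> pverts H \<and> (g, g') \<in> parcs G)" for g h g' h'
    by (auto simp: cartesian_product_def)
  have sub: "parcs (G \<box> H) \<subseteq> pverts (G \<box> H) \<times> pverts (G \<box> H)"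
    by (auto simp: arcs verts dest: G.in_arcsD1 G.in_arcsD2 H.in_arcsD1 H.in_arcsD2)
  have fin: "finite (pverts (G \<box> H))"
    by (simp add: verts G.pair_finite_verts H.pair_finite_verts)
  have "sym (parcs G)" "sym (parcs H)"
    using G.pair_sym_arcs H.pair_sym_arcs by (simp_all add: symmetric_def)
  then have sym: "sym (parcs (G \<box> H))"
    by (auto simp: arcs intro!: symI dest: symD)
  interpret pair_graph "G \<box> H"
  proof unfold_locales
    show "finite (parcs (G \<box> H))"
      using sub fin by (rule finite_subset[OF _ finite_cartesian_product]) (rule fin)
    show "symmetric (with_proj (G \<box> H))"
      using sym by (simp add: symmetric_def)
    show "fst e \<noteq> snd e" if "e \<in> parcs (G \<box> H)" for e
      using that by (cases e) (auto simp: arcs dest: G.no_loops' H.no_loops')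
  qed (use sub fin in auto)
  show ?thesis by (rule pair_graphD_graph)
qed

lemma ex_complete_digraph: "\<exists>G :: nat pair_pre_digraph. K\<^bsub>n\<^esub> (with_proj G)"
  by (rule exI[of _ "\<lparr>pverts = {..<n}, parcs = {(u, v). (u, v) \<in> {..<n} \<times> {..<n} \<and> u \<noteq> v}\<rparr>"])
    (simp add: complete_digraph_pair_def)

end

theory Submission
  imports Defs "HOL-Number_Theory.Cong"
begin

text \<open>
  Let \<open>n = 2m\<close> and number rows and columns by \<open>0, \<dots>, n - 1\<close>. The \<open>m\<close> upper rows get
  pairwise distinct colours, and column \<open>b\<close> of the upper half is copied to column
  \<open>b + 1\<close> (mod \<open>n\<close>) of the lower half, cyclically shifted downwards by \<open>b\<close>.
  So each colour occurs once in each half, and a repetition \<open>v\<^sub>1, \<dots>, v\<^sub>2\<^sub>k\<close> pairs every \<open>v\<^sub>i\<close>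
  with its twin \<open>v\<^sub>k\<^sub>+\<^sub>i\<close>. A step from \<open>v\<^sub>i\<close> to \<open>v\<^sub>i\<^sub>+\<^sub>1\<close> cannot change the half, since the twins of
  an upper and a lower cell of column \<open>b\<close> lie in the columns \<open>b + 1\<close> and \<open>b - 1\<close>. A step along
  a row has twins in a common row only if its two columns agree mod \<open>m\<close>. Hence the column
  is constant mod \<open>m\<close> along \<open>v\<^sub>1, \<dots>, v\<^sub>k\<close>, but the vertical step from \<open>v\<^sub>k\<close> to \<open>v\<^sub>k\<^sub>+\<^sub>1\<close> forces the
  columns of \<open>v\<^sub>1\<close> and of its twin, which differ by \<open>1\<close> mod \<open>m\<close>, to agree mod \<open>m\<close>.
\<close>

definition cyclic_pred :: "nat \<Rightarrow> nat \<Rightarrow> nat" where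
  "cyclic_pred n b = (if b = 0 then n - 1 else b - 1)"

text \<open>With \<open>q\<close> the cyclic predecessor of \<open>b\<close>, the summand
  \<open>2 * m - q\<close> stands for \<open>-q\<close> modulo \<open>m\<close>; on the board
  \<open>q < 2 * m\<close>, so the subtraction does not truncate.\<close>

definition cell_colour :: "nat \<Rightarrow> nat \<times> nat \<Rightarrow> nat \<times> nat" where
  "cell_colour m = (\<lambda>(a, b). if a < m then (a, b)
     else ((a + (2 * m - cyclic_pred (2 * m) b)) mod m, cyclic_pred (2 * m) b))"

definition rook_adj :: "nat \<times> nat \<Rightarrow> nat \<times> nat \<Rightarrow> bool" where
  "rook_adj x y \<longleftrightarrow> (fst x = fst y) \<noteq> (snd x = snd y)"

lemma rook_adj_cases:
  assumes "rook_adj x y"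
  obtains "fst x = fst y" "snd x \<noteq> snd y" | "fst x \<noteq> fst y" "snd x = snd y"
  using assms by (auto simp: rook_adj_def)

lemma cyclic_pred_less: "b < n \<Longrightarrow> cyclic_pred n b < n"
  by (auto simp: cyclic_pred_def)

lemma cyclic_pred_inj: "\<lbrakk>cyclic_pred n b = cyclic_pred n b'; b < n; b' < n\<rbrakk> \<Longrightarrow> b = b'"
  by (auto simp: cyclic_pred_def split: if_splits)

lemma cyclic_pred_no_two_cycle: "\<lbrakk>3 \<le> n; b < n\<rbrakk> \<Longrightarrow> cyclic_pred n (cyclic_pred n b) \<noteq> b"
  by (auto simp: cyclic_pred_def)

lemma cyclic_pred_cong:
  assumes "0 < m"
  shows "[cyclic_pred (2 * m) b + 1 = b] (mod m)"
  using assms by (auto simp: cyclic_pred_def cong_def)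

lemma cell_colour_less:
  assumes "0 < m" "x \<in> {..<2 * m} \<times> {..<2 * m}"
  shows "fst (cell_colour m x) < m" "snd (cell_colour m x) < 2 * m"
  using assms cyclic_pred_less[of "snd x" "2 * m"] by (auto simp: cell_colour_def)

text \<open>Adding the column back cancels the cyclic shift. The resulting link between rows and
  columns is what controls horizontal steps.\<close>

lemma cell_colour_twins:
  assumes eq: "cell_colour m x = cell_colour m y"
    and y: "snd y < 2 * m" and "fst x < m" "\<not> fst y < m"
  shows "snd x = cyclic_pred (2 * m) (snd y)" "[fst x + snd x = fst y] (mod m)"
proof -
  let ?q = "cyclic_pred (2 * m) (snd y)"
  have "fst x = (fst y + (2 * m - ?q)) mod m" and q: "snd x = ?q"
    using assms by (auto simp: cell_colour_def split: prod.splits if_splits)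
  then have "[fst x = fst y + (2 * m - ?q)] (mod m)"
    by (simp add: cong_def)
  then have "[fst x + ?q = fst y + (2 * m - ?q) + ?q] (mod m)"
    by (simp add: cong_add_rcancel_nat)
  also have "fst y + (2 * m - ?q) + ?q = fst y + 2 * m"
    using cyclic_pred_less[OF y] by simp
  also have "[\<dots> = fst y] (mod m)"
    by (simp add: cong_def)
  finally show "[fst x + snd x = fst y] (mod m)"
    by (simp add: q)
qed (use assms in \<open>auto simp: cell_colour_def split: prod.splits if_splits\<close>)

lemma cell_colour_twins_column:
  assumes "cell_colour m x = cell_colour m y" "snd y < 2 * m" "fst x < m" "\<not> fst y < m"
  shows "[snd x + 1 = snd y] (mod m)"
  using cell_colour_twins(1)[OF assms] cyclic_pred_cong[of m "snd y"] assms(3) by simp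

text \<open>In the upper half the colour is the cell itself. In the lower half injectivity of
  \<open>cyclic_pred\<close> fixes the column, then the shift cancels, and the \<open>m\<close>
  lower rows have distinct residues modulo \<open>m\<close>.\<close>

lemma cell_colour_halves:
  assumes eq: "cell_colour m x = cell_colour m y" and "x \<noteq> y"
    and xy: "x \<in> {..<2 * m} \<times> {..<2 * m}" "y \<in> {..<2 * m} \<times> {..<2 * m}"
  shows "fst x < m \<longleftrightarrow> \<not> fst y < m"
proof -
  have False if "fst x < m" "fst y < m"
    using that eq \<open>x \<noteq> y\<close> by (auto simp: cell_colour_def split: prod.splits)
  moreover have False if *: "\<not> fst x < m" "\<not> fst y < m"
  proof -
    obtain a b a' b' where [simp]: "x = (a, b)" "y = (a', b')"
      by (cases x, cases y)
    have "cyclic_pred (2 * m) b = cyclic_pred (2 * m) b'"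
      using eq * by (simp add: cell_colour_def)
    then have "b = b'"
      using xy by (auto intro: cyclic_pred_inj)
    then have "[a = a'] (mod m)"
      using eq * by (simp add: cell_colour_def cong_def[symmetric] cong_add_rcancel_nat)
    then have "[a - m = a' - m] (mod m)"
      using * by (simp add: cong_def le_mod_geq)
    moreover have "a - m < m" "a' - m < m"
      using xy * by auto
    ultimately have "a = a'"
      using * by (simp add: cong_def)
    with \<open>b = b'\<close> \<open>x \<noteq> y\<close> show False by simp
  qed
  ultimately show ?thesis by blast
qed

text \<open>The congruence for the lower twins serves the mirrored case of \<open>twin_step\<close>,
  where \<open>x\<close> itself is the lower one.\<close>

lemma twin_step_upper:
  assumes "2 \<le> m"
    and cells: "x \<in> {..<2 * m} \<times> {..<2 * m}" "y \<in> {..<2 * m} \<times> {..<2 * m}"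
      "x' \<in> {..<2 * m} \<times> {..<2 * m}" "y' \<in> {..<2 * m} \<times> {..<2 * m}"
    and eq: "cell_colour m x = cell_colour m x'" "cell_colour m y = cell_colour m y'"
    and x_half: "fst x < m" "\<not> fst x' < m" and y_half: "fst y < m \<longleftrightarrow> \<not> fst y' < m"
    and adj: "rook_adj x y" "rook_adj x' y'"
  shows "fst y < m" "[snd x = snd y] (mod m)" "[snd x' = snd y'] (mod m)"
proof -
  have less: "snd x < 2 * m" "snd y < 2 * m" "snd x' < 2 * m" "snd y' < 2 * m"
    using cells by auto
  note x = cell_colour_twins[OF eq(1) less(3) x_half]
  show top: "fst y < m"
  proof (rule ccontr)
    assume *: "\<not> fst y < m"
    then have "snd x = snd y" "snd x' = snd y'"
      using adj x_half y_half by (auto elim!: rook_adj_cases)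
    moreover have "snd y' = cyclic_pred (2 * m) (snd y)"
      using cell_colour_twins(1)[OF eq(2)[symmetric] less(2)] y_half * by auto
    \<comment> \<open>Otherwise \<open>cyclic_pred\<close> applied twice would fix the column
      \<open>snd x\<close>, impossible with at least four columns.\<close>
    ultimately show False
      using x(1) less cyclic_pred_no_two_cycle[of "2 * m" "snd x"] \<open>2 \<le> m\<close> by auto
  qed
  then have bot: "\<not> fst y' < m" using y_half by simp
  note y = cell_colour_twins[OF eq(2) less(4) top bot]
  from adj(1) show cong: "[snd x = snd y] (mod m)"
  proof (cases rule: rook_adj_cases)
    case 1
    \<comment> \<open>The twin step is horizontal too, so both rows stay fixed; since the twin's row
      is row plus column modulo \<open>m\<close>, the columns agree modulo \<open>m\<close>.\<close>
    then have "snd x' \<noteq> snd y'" using x y by auto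
    then have "fst x' = fst y'" using adj(2) by (auto elim: rook_adj_cases)
    then have "[fst x + snd x = fst x + snd y] (mod m)"
      using x(2) y(2) 1 by (auto simp: cong_def)
    then show ?thesis by (simp add: cong_add_lcancel_nat)
  qed simp
  have "[snd x + 1 = snd y + 1] (mod m)"
    using cong by (rule cong_add) simp
  then show "[snd x' = snd y'] (mod m)"
    using cell_colour_twins_column[OF eq(1) less(3) x_half]
      cell_colour_twins_column[OF eq(2) less(4) top bot]
    by (metis cong_sym cong_trans)
qed

lemma twin_step:
  assumes "2 \<le> m"
    and cells: "x \<in> {..<2 * m} \<times> {..<2 * m}" "y \<in> {..<2 * m} \<times> {..<2 * m}"
      "x' \<in> {..<2 * m} \<times> {..<2 * m}" "y' \<in> {..<2 * m} \<times> {..<2 * m}"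
    and eq: "cell_colour m x = cell_colour m x'" "cell_colour m y = cell_colour m y'"
    and neq: "x \<noteq> x'" "y \<noteq> y'"
    and adj: "rook_adj x y" "rook_adj x' y'"
  shows "(fst x < m \<longleftrightarrow> fst y < m) \<and> [snd x = snd y] (mod m)"
proof -
  have x_half: "fst x < m \<longleftrightarrow> \<not> fst x' < m" and y_half: "fst y < m \<longleftrightarrow> \<not> fst y' < m"
    using cell_colour_halves[OF eq(1) neq(1)] cell_colour_halves[OF eq(2) neq(2)] cells
    by blast+
  show ?thesis
  proof (cases "fst x < m")
    case True
    then show ?thesis
      using twin_step_upper[of m x y x' y'] assms(1) cells eq adj x_half y_half by blast
  next
    case False
    then show ?thesis
      using twin_step_upper[of m x' y' x y] assms(1) cells eq[symmetric] adj x_half y_half by blast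
  qed
qed

lemma cell_colour_no_repetition:
  fixes v :: "nat \<Rightarrow> nat \<times> nat"
  assumes "2 \<le> m" "1 \<le> k"
    and cells: "\<And>i. i < 2 * k \<Longrightarrow> v i \<in> {..<2 * m} \<times> {..<2 * m}"
    and adj: "\<And>i. Suc i < 2 * k \<Longrightarrow> rook_adj (v i) (v (Suc i))"
    and neq: "\<And>i. i < k \<Longrightarrow> v i \<noteq> v (k + i)"
    and eq: "\<And>i. i < k \<Longrightarrow> cell_colour m (v i) = cell_colour m (v (k + i))"
  shows False
proof -
  \<comment> \<open>The induction stops at \<open>k - 1\<close>, since \<open>twin_step\<close>
    needs both ends of a step to have twins \<open>k\<close> places later.\<close>
  have inv: "(fst (v 0) < m \<longleftrightarrow> fst (v i) < m) \<and> [snd (v 0) = snd (v i)] (mod m)"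
    if "i < k" for i
    using that
  proof (induction i)
    case 0
    then show ?case by simp
  next
    case (Suc i)
    have "(fst (v i) < m \<longleftrightarrow> fst (v (Suc i)) < m) \<and> [snd (v i) = snd (v (Suc i))] (mod m)"
    proof (rule twin_step)
      show "rook_adj (v (k + i)) (v (k + Suc i))"
        using Suc.prems adj[of "k + i"] by simp
    qed (use Suc.prems \<open>2 \<le> m\<close> in \<open>auto intro!: cells adj neq eq simp del: add_Suc_right\<close>)
    with Suc show ?case by (auto intro: cong_trans)
  qed
  have eq0: "cell_colour m (v 0) = cell_colour m (v k)" and "v 0 \<noteq> v k"
    using eq[of 0] neq[of 0] \<open>1 \<le> k\<close> by auto
  have cell0: "v 0 \<in> {..<2 * m} \<times> {..<2 * m}" and cellk: "v k \<in> {..<2 * m} \<times> {..<2 * m}"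
    using cells[of 0] cells[of k] \<open>1 \<le> k\<close> by auto
  have half: "fst (v 0) < m \<longleftrightarrow> \<not> fst (v k) < m"
    using cell_colour_halves[OF eq0 \<open>v 0 \<noteq> v k\<close> cell0 cellk] .
  have last: "fst (v 0) < m \<longleftrightarrow> fst (v (k - 1)) < m" "[snd (v 0) = snd (v (k - 1))] (mod m)"
    using inv[of "k - 1"] \<open>1 \<le> k\<close> by auto
  \<comment> \<open>\<open>v (k - 1)\<close> is still in the half of \<open>v 0\<close>, so this
    step changes the half and must be vertical.\<close>
  have "rook_adj (v (k - 1)) (v k)"
    using adj[of "k - 1"] \<open>1 \<le> k\<close> by simp
  then have "snd (v (k - 1)) = snd (v k)"
    using half last(1) by (auto elim!: rook_adj_cases)
  then have cong: "[snd (v 0) = snd (v k)] (mod m)"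
    using last(2) by simp
  \<comment> \<open>Either of \<open>v 0\<close> and \<open>v k\<close> may be the upper twin; both
    cases lead to \<open>1 = 0\<close> modulo \<open>m\<close>.\<close>
  have "[snd (v 0) + 1 = snd (v k)] (mod m) \<or> [snd (v k) + 1 = snd (v 0)] (mod m)"
    using cell_colour_twins_column[OF eq0] cell_colour_twins_column[OF eq0[symmetric]]
      half cell0 cellk by auto
  then have "[snd (v 0) + 1 = snd (v 0) + 0] (mod m) \<or> [snd (v k) + 1 = snd (v k) + 0] (mod m)"
    using cong cong_sym cong_trans by (metis add_0_right)
  then have "[1 = 0] (mod m)"
    by (simp only: cong_add_lcancel_nat disj_absorb)
  then show False
    using \<open>2 \<le> m\<close> by (simp add: cong_def)
qed

lemma vwalk_nth_arc:
  assumes "vwalk p G" "Suc i < length p"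
  shows "(p ! i, p ! Suc i) \<in> arcs_ends G"
proof -
  have "(p ! i, p ! Suc i) \<in> set (vwalk_arcs p)"
    using assms(2) by (induction p arbitrary: i rule: vwalk_arcs.induct)
      (auto simp: nth_Cons split: nat.splits)
  with assms(1) show ?thesis by (auto simp: vwalk_def)
qed

theorem theorem6:
  fixes n :: nat
    and G :: "'a pair_pre_digraph" and H :: "'b pair_pre_digraph"
  assumes "even n" and "n \<ge> 4"
    and "K\<^bsub>n\<^esub> (with_proj G)" and "K\<^bsub>n\<^esub> (with_proj H)"
  shows "real (nonrep_number (with_proj (G \<box> H))) \<le> real n ^ 2 / 2"
proof -
  obtain m where n: "n = 2 * m" using \<open>even n\<close> by (elim evenE)
  with \<open>n \<ge> 4\<close> have m: "2 \<le> m" by simp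
  have G: "finite (pverts G)" "card (pverts G) = n"
      "parcs G = {(u, v). (u, v) \<in> pverts G \<times> pverts G \<and> u \<noteq> v}"
    and H: "finite (pverts H)" "card (pverts H) = n"
      "parcs H = {(u, v). (u, v) \<in> pverts H \<times> pverts H \<and> u \<noteq> v}"
    using assms(3,4) by (simp_all add: complete_digraph_pair_def)
  \<comment> \<open>Numbering both vertex sets turns product vertices into cells and arcs into rook
    moves.\<close>
  obtain f g where f: "bij_betw f (pverts G) {..<n}" and g: "bij_betw g (pverts H) {..<n}"
    using ex_bij_betw_finite_nat[OF G(1)] ex_bij_betw_finite_nat[OF H(1)] G(2) H(2)
    by (auto simp: atLeast0LessThan)
  let ?P = "with_proj (G \<box> H)"
  define e where "e = map_prod f g"
  have verts: "verts ?P = pverts G \<times> pverts H"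
    by (simp add: cartesian_product_def)
  have e_inj: "inj_on e (verts ?P)"
    using f g unfolding e_def verts by (auto intro: map_prod_inj_on simp: bij_betw_def)
  have e_cell: "e x \<in> {..<2 * m} \<times> {..<2 * m}" if "x \<in> verts ?P" for x
    using that bij_betwE[OF f] bij_betwE[OF g] n unfolding e_def verts by auto
  have e_adj: "rook_adj (e x) (e y)" if "(x, y) \<in> arcs_ends ?P" for x y
    using that f g G(3) H(3)
    by (auto simp: cartesian_product_def e_def rook_adj_def bij_betw_def dest: inj_onD)
  \<comment> \<open>The pair becomes a two-digit number, low digit below \<open>m\<close> and high
    digit below \<open>2 * m\<close>; it is decoded by \<open>mod\<close> and \<open>div\<close>,
    and there are \<open>m * n\<close> values.\<close>
  define c where "c x = (case cell_colour m (e x) of (a, b) \<Rightarrow> a + m * b)" for x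
  have less: "fst (cell_colour m (e x)) < m" "snd (cell_colour m (e x)) < 2 * m"
    if "x \<in> verts ?P" for x
    using cell_colour_less[OF _ e_cell[OF that]] m by auto
  have c_eq: "cell_colour m (e x) = cell_colour m (e y)"
    if "x \<in> verts ?P" "y \<in> verts ?P" "c x = c y" for x y
  proof -
    have "c x mod m = c y mod m" "c x div m = c y div m"
      using that(3) by simp_all
    then show ?thesis
      using less[OF that(1)] less[OF that(2)] m
      by (auto simp: c_def prod_eq_iff split: prod.splits)
  qed
  have c_less: "c x < m * n" if "x \<in> verts ?P" for x
  proof -
    obtain a b where ab: "cell_colour m (e x) = (a, b)" by fastforce
    then have "a + m * b < m * Suc b" "Suc b \<le> 2 * m"
      using less[OF that] by auto
    then show ?thesis
      using mult_le_mono2[of "Suc b" "2 * m" m] by (auto simp: c_def ab n)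
  qed
  have "nonrepetitive ?P c"
    unfolding nonrepetitive_def
  proof (intro notI, elim exE conjE)
    fix p k
    assume k: "k \<ge> (1::nat)" and p: "vpath p ?P" and len: "length p = 2 * k"
      and rep: "\<forall>i<k. c (p ! i) = c (p ! (k + i))"
    have walk: "vwalk p ?P" and dist: "distinct p"
      using p by (auto simp: vpath_def)
    have in_verts: "p ! i \<in> verts ?P" if "i < 2 * k" for i
      using walk that len by (metis nth_mem subsetD vwalk_def)
    show False
    proof (rule cell_colour_no_repetition[OF m k, of "\<lambda>i. e (p ! i)"])
      fix i assume "i < 2 * k"
      then show "e (p ! i) \<in> {..<2 * m} \<times> {..<2 * m}" by (intro e_cell in_verts)
    next
      fix i assume "Suc i < 2 * k"
      then show "rook_adj (e (p ! i)) (e (p ! Suc i))"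
        using walk len by (intro e_adj vwalk_nth_arc) auto
    next
      fix i assume i: "i < k"
      then have "p ! i \<noteq> p ! (k + i)"
        using dist len k by (simp add: nth_eq_iff_index_eq)
      then show "e (p ! i) \<noteq> e (p ! (k + i))"
        using e_inj in_verts[of i] in_verts[of "k + i"] i by (auto dest: inj_onD)
      show "cell_colour m (e (p ! i)) = cell_colour m (e (p ! (k + i)))"
        using rep i by (intro c_eq in_verts) auto
    qed
  qed
  with c_less have "nonrep_number ?P \<le> m * n"
    unfolding nonrep_number_def by (intro Least_le exI[of _ c]) auto
  then have "real (nonrep_number ?P) \<le> real (m * n)"
    by (simp only: of_nat_le_iff)
  also have "\<dots> = real n ^ 2 / 2"
    by (simp add: n power2_eq_square)
  finally show ?thesis .
qed

end
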